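(* Let $V$ be a finite totally ordered set (of even size) such that $|V|\geq 6$, and let $P$ be a pairing of $V$. The following assertions are equivalent. (1) The pairing $P$ is irreducible. (2) The tournament $\mathrm{Inv}(\underline{V},P)$ is indecomposable.
   Context: A tournament $T=(V(T),A(T))$ consists of a finite vertex set $V(T)$ and a set $A(T)$ of ordered pairs of distinct vertices (arcs) such that for all $x\neq y$ in $V(T)$, $(x,y)\in A(T)$ if and only if $(y,x)\notin A(T)$. For a totally ordered set $V$, $\underline{V}$ denotes the transitive tournament $(V,\{(x,y)\in V\times V: x<y\})$. For $P\subseteq \binom{V}{2}$ (a set of unordered pairs of distinct elements), $\mathrm{Inv}(\underline{V},P)$ is the tournament on $V$ obtained from $\underline{V}$ by reversing every arc $(x,y)$ such that $\{x,y\}\in P$. A module of a tournament $T$ is a subset $M\subseteq V(T)$ such that for every $v\in V(T)\setminus M$, either $\{v\}\times M\subseteq A(T)$ or $M\times\{v\}\subseteq A(T)$. The trivial modules are $\emptyset$, $V(T)$ and the singletons. $T$ is indecomposable if all its modules are trivial. A pairing of $V$ is a partition of $V$ all of whose blocks have size $2$. An interval of a totally ordered set $V$ is a subset $I\subseteq V$ such that every element of $V\setminus I$ is greater than all the elements of $I$ or smaller than all of them; it is nontrivial if it is neither $\emptyset$, nor a singleton, nor $V$. A pairing of $V$ is irreducible if no nontrivial interval of $V$ is a union of blocks. *)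

theory Defs
  imports "Graph_Theory.Pair_Digraph" "HOL-Library.Disjoint_Sets"
begin

locale tournament = pair_digraph T for T :: "'a pair_pre_digraph" +
  assumes tournament_arcs:
    "\<lbrakk>x \<in> pverts T; y \<in> pverts T; x \<noteq> y\<rbrakk> \<Longrightarrow> (x, y) \<in> parcs T \<longleftrightarrow> (y, x) \<notin> parcs T"

definition transitive_tournament :: "'a::linorder set \<Rightarrow> 'a pair_pre_digraph" where
  "transitive_tournament V = \<lparr>pverts = V, parcs = {(x, y) \<in> V \<times> V. x < y}\<rparr>"

definition Inv :: "'a pair_pre_digraph \<Rightarrow> 'a set set \<Rightarrow> 'a pair_pre_digraph" where
  "Inv T P = \<lparr>pverts = pverts T,
     parcs = {(x, y) \<in> parcs T. {x, y} \<notin> P} \<union> {(y, x) | x y. (x, y) \<in> parcs T \<and> {x, y} \<in> P}\<rparr>"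

definition tournament_module :: "'a pair_pre_digraph \<Rightarrow> 'a set \<Rightarrow> bool" where
  "tournament_module T M \<longleftrightarrow> M \<subseteq> pverts T \<and>
     (\<forall>v \<in> pverts T - M. {v} \<times> M \<subseteq> parcs T \<or> M \<times> {v} \<subseteq> parcs T)"

definition indecomposable :: "'a pair_pre_digraph \<Rightarrow> bool" where
  "indecomposable T \<longleftrightarrow>
     (\<forall>M. tournament_module T M \<longrightarrow> M = {} \<or> M = pverts T \<or> is_singleton M)"

definition pairing :: "'a set \<Rightarrow> 'a set set \<Rightarrow> bool" where
  "pairing V P \<longleftrightarrow> partition_on V P \<and> (\<forall>B \<in> P. card B = 2)"

text \<open>Intervals are relative to the ordered set \<open>V\<close>, which need not be the whole type.\<close>

definition interval_in :: "'a::linorder set \<Rightarrow> 'a set \<Rightarrow> bool" where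
  "interval_in V I \<longleftrightarrow> I \<subseteq> V \<and> (\<forall>v \<in> V - I. (\<forall>i \<in> I. i < v) \<or> (\<forall>i \<in> I. v < i))"

definition nontrivial_interval_in :: "'a::linorder set \<Rightarrow> 'a set \<Rightarrow> bool" where
  "nontrivial_interval_in V I \<longleftrightarrow> interval_in V I \<and> I \<noteq> {} \<and> \<not> is_singleton I \<and> I \<noteq> V"

definition irreducible_pairing :: "'a::linorder set \<Rightarrow> 'a set set \<Rightarrow> bool" where
  "irreducible_pairing V P \<longleftrightarrow> \<not> (\<exists>I. nontrivial_interval_in V I \<and> (\<exists>Q \<subseteq> P. I = \<Union>Q))"

lemma tournament_transitive_tournament:
  assumes "finite V"
  shows "tournament (transitive_tournament V)"
proof -
  have "{(x, y) \<in> V \<times> V. x < y} \<subseteq> V \<times> V" by auto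
  then have "finite {(x, y) \<in> V \<times> V. x < y}"
    using assms by (meson finite_SigmaI finite_subset)
  with assms show ?thesis
    by unfold_locales (auto simp: transitive_tournament_def)
qed

lemma tournament_Inv:
  assumes "tournament T"
  shows "tournament (Inv T P)"
proof -
  interpret tournament T by fact
  have sub: "parcs (Inv T P) \<subseteq> pverts T \<times> pverts T"
    by (auto simp: Inv_def dest: in_arcsD1 in_arcsD2)
  then have fin: "finite (parcs (Inv T P))"
    using pair_finite_verts by (meson finite_SigmaI finite_subset)
  show ?thesis
  proof unfold_locales
    fix x y
    assume "x \<in> pverts (Inv T P)" "y \<in> pverts (Inv T P)" "x \<noteq> y"
    then show "(x, y) \<in> parcs (Inv T P) \<longleftrightarrow> (y, x) \<notin> parcs (Inv T P)"
      using tournament_arcs[of x y] by (auto simp: Inv_def insert_commute)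
  next
    fix e assume "e \<in> parcs (Inv T P)"
    then show "fst e \<noteq> snd e"
      using pair_no_loops by (fastforce simp: Inv_def)
  qed (use fin pair_finite_verts in \<open>auto simp: Inv_def dest: in_arcsD1 in_arcsD2\<close>)
qed

end

theory Submission
  imports Defs
begin

text \<open>
  An interval that is a union of blocks is a module, because reversals only affect arcs inside
  blocks. Conversely, let \<open>M\<close> be a nontrivial module with minimum \<open>a\<close> and maximum \<open>b\<close>. A vertex
  \<open>v\<close> outside \<open>M\<close> sees the elements of \<open>M\<close> other than its partner according to the order. So the
  partner of a vertex outside \<open>[a, b]\<close> is not in \<open>M\<close>, and a vertex of \<open>[a, b] - M\<close> is either the
  partner of \<open>a\<close> and above no other element of \<open>M\<close>, or the partner of \<open>b\<close> and below no other
  element of \<open>M\<close>. Hence \<open>[a, b]\<close> is closed under partners, and irreducibility gives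
  \<open>V = [a, b]\<close>. Now either \<open>a\<close> or \<open>b\<close> is adjacent in the order to its partner, contradicting
  irreducibility, or \<open>V\<close> consists of \<open>a\<close>, \<open>b\<close> and their partners, contradicting \<open>|V| \<ge> 6\<close>.
\<close>

definition partner :: "'a set set \<Rightarrow> 'a \<Rightarrow> 'a" where
  "partner P x = (THE y. y \<noteq> x \<and> {x, y} \<in> P)"

lemma pairing_partner:
  assumes "pairing V P"
  shows "x \<in> V \<Longrightarrow> partner P x \<in> V"
    and "x \<in> V \<Longrightarrow> partner P x \<noteq> x"
    and "x \<in> V \<Longrightarrow> partner P (partner P x) = x"
    and "x \<in> V \<Longrightarrow> {x, y} \<in> P \<longleftrightarrow> y = partner P x"
    and "B \<in> P \<Longrightarrow> x \<in> B \<Longrightarrow> B = {x, partner P x}"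
proof -
  have part: "partition_on V P" and two: "\<And>B. B \<in> P \<Longrightarrow> card B = 2"
    using assms by (auto simp: pairing_def)
  have uniq: "B = C" if "B \<in> P" "C \<in> P" "x \<in> B" "x \<in> C" for B C x
    using part that by (auto simp: partition_on_def disjoint_def)
  have sub: "B \<subseteq> V" if "B \<in> P" for B
    using part that by (auto simp: partition_on_def)
  have p: "partner P x \<noteq> x \<and> {x, partner P x} \<in> P" if "x \<in> V" for x
    unfolding partner_def
  proof (rule theI')
    obtain B where B: "B \<in> P" "x \<in> B"
      using part \<open>x \<in> V\<close> by (auto simp: partition_on_def)
    then obtain u w where "B = {u, w}" "u \<noteq> w"
      using two card_2_iff by metis
    then have "\<exists>y. y \<noteq> x \<and> {x, y} \<in> P"
      using B by (auto simp: insert_commute)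
    moreover have "y = z" if "{x, y} \<in> P" "{x, z} \<in> P" for y z
      using uniq[OF that, of x] by (auto simp: doubleton_eq_iff)
    ultimately show "\<exists>!y. y \<noteq> x \<and> {x, y} \<in> P" by blast
  qed
  have in_V: "partner P x \<in> V" if "x \<in> V" for x
    using sub p[OF that] by auto
  have iff: "{x, y} \<in> P \<longleftrightarrow> y = partner P x" if "x \<in> V" for x y
    using uniq[of "{x, y}" "{x, partner P x}" x] p[OF that] by (auto simp: doubleton_eq_iff)
  show "x \<in> V \<Longrightarrow> partner P x \<in> V" by (rule in_V)
  show "x \<in> V \<Longrightarrow> partner P x \<noteq> x" using p by blast
  show "x \<in> V \<Longrightarrow> partner P (partner P x) = x"
    using iff[of "partner P x" x] in_V p by (simp add: insert_commute)
  show "x \<in> V \<Longrightarrow> {x, y} \<in> P \<longleftrightarrow> y = partner P x" by (rule iff)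
  show "B \<in> P \<Longrightarrow> x \<in> B \<Longrightarrow> B = {x, partner P x}"
    using uniq[of B "{x, partner P x}" x] sub p by blast
qed

lemma parcs_Inv_transitive_tournament:
  "(x, y) \<in> parcs (Inv (transitive_tournament V) P) \<longleftrightarrow>
     x \<in> V \<and> y \<in> V \<and> x \<noteq> y \<and> (x < y \<longleftrightarrow> {x, y} \<notin> P)"
  by (auto simp: Inv_def transitive_tournament_def insert_commute)

lemma pverts_Inv_transitive_tournament: "pverts (Inv (transitive_tournament V) P) = V"
  by (simp add: Inv_def transitive_tournament_def)

lemma tournament_module_union_of_blocks:
  assumes "pairing V P" and "interval_in V I" and "Q \<subseteq> P" and "I = \<Union>Q"
  shows "tournament_module (Inv (transitive_tournament V) P) I"
proof -
  note p = pairing_partner[OF assms(1)]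
  have I: "I \<subseteq> V" and side: "\<And>v. v \<in> V - I \<Longrightarrow> (\<forall>i\<in>I. i < v) \<or> (\<forall>i\<in>I. v < i)"
    using assms(2) by (auto simp: interval_in_def)
  have "partner P x \<in> I" if x: "x \<in> I" for x
  proof -
    obtain B where "B \<in> Q" "x \<in> B" using x assms(4) by blast
    moreover from this have "B = {x, partner P x}" using p(5) assms(3) by blast
    ultimately show ?thesis using assms(4) by blast
  qed
  \<comment> \<open>No block joins \<open>I\<close> to its complement, so the arcs between them keep
    the direction of the order.\<close>
  then have block: "{v, i} \<notin> P" "{i, v} \<notin> P" if "v \<in> V - I" "i \<in> I" for v i
    using p(4)[of i v] I that by (auto simp: insert_commute)
  have "{v} \<times> I \<subseteq> parcs (Inv (transitive_tournament V) P) \<or>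
        I \<times> {v} \<subseteq> parcs (Inv (transitive_tournament V) P)" if v: "v \<in> V - I" for v
    using side[OF v] block[OF v] I v
    by (auto simp: subset_iff parcs_Inv_transitive_tournament)
  then show ?thesis
    using I by (simp add: tournament_module_def pverts_Inv_transitive_tournament)
qed

text \<open>Irreducibility in the form used below: closure under partners makes \<open>I\<close> the
  union of the blocks it contains, and \<open>x\<close>, \<open>y\<close> rule out a trivial
  \<open>I\<close> other than \<open>V\<close>.\<close>

lemma irreducible_pairing_closed:
  fixes V :: "'a::linorder set"
  assumes "irreducible_pairing V P" and "pairing V P"
    and "interval_in V I" and "x \<in> I" "y \<in> I" "x \<noteq> y"
    and closed: "\<And>x y. x \<in> I \<Longrightarrow> {x, y} \<in> P \<Longrightarrow> y \<in> I"
  shows "I = V"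
proof (rule ccontr)
  assume "I \<noteq> V"
  have "I \<subseteq> V" using assms(3) by (simp add: interval_in_def)
  have "I \<subseteq> \<Union>{B \<in> P. B \<subseteq> I}"
  proof
    fix x assume x: "x \<in> I"
    then have "{x, partner P x} \<in> P"
      using pairing_partner(4)[OF assms(2)] \<open>I \<subseteq> V\<close> by blast
    with x closed show "x \<in> \<Union>{B \<in> P. B \<subseteq> I}" by blast
  qed
  then have "\<exists>Q\<subseteq>P. I = \<Union>Q"
    by (intro exI[of _ "{B \<in> P. B \<subseteq> I}"]) auto
  moreover have "nontrivial_interval_in V I"
    using assms(3-6) \<open>I \<noteq> V\<close> by (auto simp: nontrivial_interval_in_def is_singleton_def)
  ultimately show False
    using assms(1) unfolding irreducible_pairing_def by blast
qed

text \<open>Four elements are too few: for 1 < 2 < 3 < 4 with blocks {1, 3} and {2, 4}, the pairing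
  is irreducible, yet {1, 4} is a module.\<close>

lemma irreducible_pairing_imp_indecomposable:
  fixes V :: "'a::linorder set"
  assumes fin: "finite V" and card: "card V > 4"
    and pairing: "pairing V P" and irr: "irreducible_pairing V P"
  shows "indecomposable (Inv (transitive_tournament V) P)"
proof (rule ccontr)
  let ?T = "Inv (transitive_tournament V) P"
  assume "\<not> ?thesis"
  then obtain M where M: "tournament_module ?T M" "M \<noteq> {}" "M \<noteq> V" "\<not> is_singleton M"
    unfolding indecomposable_def pverts_Inv_transitive_tournament by blast
  define p where "p = partner P"
  note p = pairing_partner[OF pairing, folded p_def]
  have MV: "M \<subseteq> V"
    using M(1) by (simp add: tournament_module_def pverts_Inv_transitive_tournament)
  then have "finite M" using fin finite_subset by blast
  define a b where "a = Min M" and "b = Max M"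
  have ab: "a \<in> M" "b \<in> M" and between: "\<And>x. x \<in> M \<Longrightarrow> a \<le> x \<and> x \<le> b"
    using \<open>finite M\<close> M(2) by (auto simp: a_def b_def)
  have "a \<noteq> b"
    using M(4) ab(1) between by (metis is_singletonI' order.antisym empty_iff)
  then have "a < b" using between[OF ab(1)] by simp
  have abV: "a \<in> V" "b \<in> V" using ab MV by auto

  \<comment> \<open>Either \<open>v\<close> dominates \<open>M\<close> or \<open>M\<close> dominates
    \<open>v\<close>; the order predicts the arc except at \<open>p v\<close>, which may lie outside
    \<open>M\<close>.\<close>
  have module: "(\<forall>x\<in>M. v < x \<longleftrightarrow> x \<noteq> p v) \<or> (\<forall>x\<in>M. x < v \<longleftrightarrow> x \<noteq> p v)"
    if "v \<in> V - M" for v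
  proof -
    have "{v} \<times> M \<subseteq> parcs ?T \<or> M \<times> {v} \<subseteq> parcs ?T"
      using M(1) that by (simp add: tournament_module_def pverts_Inv_transitive_tournament)
    moreover have "{x, v} \<in> P \<longleftrightarrow> x = p v" for x
      using p(4) that by (simp add: insert_commute)
    ultimately show ?thesis
      using p(4) that by (auto simp: subset_iff parcs_Inv_transitive_tournament)
  qed
  \<comment> \<open>One of \<open>a\<close>, \<open>b\<close> is not \<open>p v\<close>, and its arc
    with \<open>v\<close> follows the order; an element \<open>p v\<close> of \<open>M\<close> would
    have the opposite arc.\<close>
  have outside: "p v \<notin> M" if "v \<in> V" "v < a \<or> b < v" for v
    using module[of v] that ab between \<open>a < b\<close>
    by (metis DiffI leD less_le_trans less_trans not_less_iff_gr_or_eq order.strict_iff_order)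
  \<comment> \<open>As \<open>a\<close> and \<open>b\<close> lie on opposite sides of
    \<open>v\<close>, one of them must be \<open>p v\<close>; it is then the only element of
    \<open>M\<close> on its side of \<open>v\<close>.\<close>
  have gap: "v = p a \<and> (\<forall>x\<in>M. x < v \<longrightarrow> x = a) \<or> v = p b \<and> (\<forall>x\<in>M. v < x \<longrightarrow> x = b)"
    if "v \<in> V - M" "a < v" "v < b" for v
    using module[OF that(1)]
  proof
    assume "\<forall>x\<in>M. v < x \<longleftrightarrow> x \<noteq> p v"
    then show ?thesis using that ab p(3)[of v] by (metis DiffD1 less_asym)
  next
    assume "\<forall>x\<in>M. x < v \<longleftrightarrow> x \<noteq> p v"
    then show ?thesis using that ab p(3)[of v] by (metis DiffD1 less_asym)
  qed

  \<comment> \<open>The interval spanned by \<open>M\<close> is closed: \<open>outside\<close>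
    handles partners of elements of \<open>M\<close>, and by \<open>gap\<close> every other element
    has partner \<open>a\<close> or \<open>b\<close>.\<close>
  have "{x\<in>V. a \<le> x \<and> x \<le> b} = V"
  proof (rule irreducible_pairing_closed[OF irr pairing, where x = a and y = b])
    show "interval_in V {x\<in>V. a \<le> x \<and> x \<le> b}"
      by (auto simp: interval_in_def)
    fix x y assume x: "x \<in> {x\<in>V. a \<le> x \<and> x \<le> b}" and "{x, y} \<in> P"
    then have "y = p x" using p(4) by simp
    moreover have "a \<le> p x \<and> p x \<le> b"
    proof (cases "x \<in> M")
      case True
      then show ?thesis
        using outside[of "p x"] p(1,3) x by (metis mem_Collect_eq not_le)
    next
      case False
      then have "a < x" "x < b" using x ab by (auto simp: order.strict_iff_order)
      then have "p x \<in> M" using gap[of x] False x p(3) ab abV by auto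
      then show ?thesis using between by simp
    qed
    ultimately show "y \<in> {x\<in>V. a \<le> x \<and> x \<le> b}" using x p(1) by simp
  qed (use \<open>a < b\<close> abV in auto)
  then have range: "\<And>x. x \<in> V \<Longrightarrow> a \<le> x \<and> x \<le> b" by blast

  have no_pair: "\<not> interval_in V {x, p x}" if "x \<in> V" for x
  proof
    assume "interval_in V {x, p x}"
    then have "{x, p x} = V"
      by (rule irreducible_pairing_closed[OF irr pairing, of _ x "p x"])
        (use p that in \<open>auto dest: not_sym\<close>)
    then have "card V \<le> 2" using card_insert_le_m1[of 2 "{p x}" x] by simp
    then show False using card by simp
  qed
  \<comment> \<open>Now \<open>a\<close> is the minimum of \<open>V\<close>, so without such a
    \<open>w\<close> the block of \<open>a\<close> would be an initial interval.\<close>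
  have low: "\<exists>w\<in>V. a < w \<and> w < p a"
  proof (rule ccontr)
    assume "\<not> ?thesis"
    then have "a < v \<and> p a < v" if "v \<in> V - {a, p a}" for v
      using that range[of v] by (auto simp: order.strict_iff_order)
    then have "interval_in V {a, p a}"
      using p(1) abV by (auto simp: interval_in_def)
    then show False using no_pair abV by blast
  qed
  have high: "\<exists>w\<in>V. p b < w \<and> w < b"
  proof (rule ccontr)
    assume "\<not> ?thesis"
    then have "v < b \<and> v < p b" if "v \<in> V - {b, p b}" for v
      using that range[of v] by (auto simp: order.strict_iff_order)
    then have "interval_in V {b, p b}"
      using p(1) abV by (auto simp: interval_in_def)
    then show False using no_pair abV by blast
  qed

  have inner: "a < v \<and> v < b" if "v \<in> V - M" for v
    using that range[of v] ab by (auto simp: order.strict_iff_order)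
  have gap_set: "v = p a \<or> v = p b" if "v \<in> V - M" for v
    using gap[OF that] inner[OF that] by blast
  have "p a \<noteq> p b" using p(3) abV \<open>a \<noteq> b\<close> by metis
  have below: "x = a \<or> x = p b"
    if "p a \<in> V - M" "\<forall>x\<in>M. x < p a \<longrightarrow> x = a" "x \<in> V" "x < p a" for x
    using that gap_set[of x] by auto
  have above: "x = b \<or> x = p a"
    if "p b \<in> V - M" "\<forall>x\<in>M. p b < x \<longrightarrow> x = b" "x \<in> V" "p b < x" for x
    using that gap_set[of x] by auto
  have gap_a: "\<forall>x\<in>M. x < p a \<longrightarrow> x = a" if "p a \<in> V - M"
    using gap[OF that] inner[OF that] \<open>p a \<noteq> p b\<close> by blast
  have gap_b: "\<forall>x\<in>M. p b < x \<longrightarrow> x = b" if "p b \<in> V - M"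
    using gap[OF that] inner[OF that] \<open>p a \<noteq> p b\<close> by metis
  \<comment> \<open>The \<open>w\<close> from \<open>low\<close> cannot be in \<open>M\<close> by
    \<open>gap_a\<close>, so \<open>gap_set\<close> leaves only \<open>p b\<close>. This also gives
    the order of the two partners, needed for the final covering.\<close>
  have a_imp_b: "p b \<in> V - M \<and> p b < p a" if "p a \<in> V - M"
  proof -
    obtain w where w: "w \<in> V" "a < w" "w < p a" using low by blast
    then have "w \<notin> M" "w = p b"
      using gap_a[OF that] below[OF that] by auto
    then show ?thesis using w by blast
  qed
  have b_imp_a: "p a \<in> V - M" if "p b \<in> V - M"
  proof -
    obtain w where w: "w \<in> V" "p b < w" "w < b" using high by blast
    then have "w \<notin> M" "w = p a"
      using gap_b[OF that] above[OF that] by auto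
    then show ?thesis using w by blast
  qed
  obtain v where "v \<in> V - M" using MV M(3) by blast
  then have "p a \<in> V - M" using gap_set b_imp_a by metis
  then have both: "p a \<in> V - M" "p b \<in> V - M" "p b < p a" using a_imp_b by auto
  have "V \<subseteq> {a, b, p a, p b}"
  proof
    fix x assume "x \<in> V"
    \<comment> \<open>Since \<open>p b < p a\<close>, the ranges of \<open>below\<close> and
      \<open>above\<close> overlap and together exhaust \<open>V\<close>.\<close>
    moreover have "x < p a \<or> p b < x" using both(3) by (meson le_less_trans not_less)
    ultimately show "x \<in> {a, b, p a, p b}"
      using below[OF both(1) gap_a] above[OF both(2) gap_b] both by blast
  qed
  then have "card V \<le> card {a, b, p a, p b}" by (simp add: card_mono)
  also have "\<dots> \<le> 4" by (simp add: card_insert_if)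
  finally show False using card by simp
qed

theorem corollary3p1:
  fixes V :: "'a::linorder set" and P :: "'a set set"
  assumes "finite V" and "even (card V)" and "card V \<ge> 6"
    and "pairing V P"
  shows "irreducible_pairing V P \<longleftrightarrow> indecomposable (Inv (transitive_tournament V) P)"
proof
  assume "irreducible_pairing V P"
  then show "indecomposable (Inv (transitive_tournament V) P)"
    using assms by (intro irreducible_pairing_imp_indecomposable) auto
next
  assume "indecomposable (Inv (transitive_tournament V) P)"
  then have modules: "I = {} \<or> I = V \<or> is_singleton I"
    if "tournament_module (Inv (transitive_tournament V) P) I" for I
    using that by (simp add: indecomposable_def pverts_Inv_transitive_tournament)
  show "irreducible_pairing V P"
    unfolding irreducible_pairing_def
  proof (intro notI, elim exE conjE)
    fix I Q
    assume I: "nontrivial_interval_in V I" and "Q \<subseteq> P" "I = \<Union>Q"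
    then have "tournament_module (Inv (transitive_tournament V) P) I"
      by (intro tournament_module_union_of_blocks[OF assms(4)])
        (simp_all add: nontrivial_interval_in_def)
    then show False
      using modules I by (auto simp: nontrivial_interval_in_def)
  qed
qed

end
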